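(* SDD programming is equivalent to second-order cone programming (SOCP): every SOCP can be cast into an SDD program, and every SDD program can be cast into an SOCP.
   Context: $\mathbb{S}^d$ is the space of real symmetric $d\times d$ matrices and $\mathbb{S}^2_+$ the cone of $2\times2$ positive semidefinite matrices. For $1\le i<j\le d$, the lift $\varepsilon^d_{ij}:\mathbb{S}^2\to\mathbb{S}^d$ places a $2\times 2$ matrix in the rows and columns $i,j$ and fills all other entries with $0$. For $d\ge2$, let $(\mathbb{S}^d_+)_2=\{\sum_{i<j}\varepsilon^d_{ij}(M^{ij}):M^{ij}\in\mathbb{S}^2_+\}$ (this cone coincides with the set of symmetric scaled diagonally dominant matrices with nonnegative diagonals, i.e. $A\in\mathbb{S}^d$ for which there are $\delta_1,\dots,\delta_d>0$ with $\delta_ia_{ii}\ge\sum_{j\ne i}\delta_j|a_{ij}|$ for all $i$). An SDD program is the second-order instance ($k=2$) of the cone program induced by the positive semidefinite cones, in standard form: minimize $\operatorname{tr}(A_0X)$ over $X\in\mathbb{S}^d$ subject to $\operatorname{tr}(A_iX)=b_i$ ($i=1,\dots,p$), $X\in(\mathbb{S}^d_+)_2$; or in inequality form: minimize $q^{\mathsf T}x$ over $x\in\mathbb{R}^n$ subject to $x_1P_1+\dots+x_nP_n+P_0\in(\mathbb{S}^d_+)_2$, with $P_i\in\mathbb{S}^d$. The dimension $d$ is arbitrary and may vary between programs. An SOCP is a problem: minimize $a^{\mathsf T}x$ over $x\in\mathbb{R}^n$ subject to $\|A_ix+b_i\|_2\le c_i^{\mathsf T}x+d_i$ ($i=1,\dots,q$)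 and $Bx=e$, with given real matrices $A_i,B$, vectors $a,b_i,c_i,e$ and scalars $d_i$. A program $P$ (variable space $V_P$, feasible set $F_P$, objective $c_P$) can be cast into a program $Q$ (with $V_Q,F_Q,c_Q$) if there is an affine map $\pi:V_Q\to V_P$ with $\pi(F_Q)=F_P$ and $c_P(\pi(v))=c_Q(v)$ for all $v\in F_Q$. *)

theory Defs
  imports Complex_Main "Jordan_Normal_Form.Matrix"
begin

text \<open>
  Dimensions vary between programs, so vectors and matrices are the dimension-carrying types
  of \<^theory>\<open>Jordan_Normal_Form.Matrix\<close>. Their entries are indexed from \<open>0\<close>.
\<close>

section \<open>Programs and casting\<close>

text \<open>
  Only the values of \<open>objective\<close> on \<open>feasible\<close>, a subset of the carrier of \<open>var_space\<close>, matter.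
\<close>

record 'v program =
  var_space :: "(real, 'v) module"
  feasible :: "'v set"
  objective :: "'v \<Rightarrow> real"

definition affine_map :: "(real, 'v) module \<Rightarrow> (real, 'w) module \<Rightarrow> ('v \<Rightarrow> 'w) \<Rightarrow> bool" where
  "affine_map V W f \<longleftrightarrow> f \<in> carrier V \<rightarrow> carrier W \<and>
    (\<forall>x\<in>carrier V. \<forall>y\<in>carrier V. \<forall>t.
      f (((1 - t) \<odot>\<^bsub>V\<^esub> x) \<oplus>\<^bsub>V\<^esub> (t \<odot>\<^bsub>V\<^esub> y)) =
        ((1 - t) \<odot>\<^bsub>W\<^esub> f x) \<oplus>\<^bsub>W\<^esub> (t \<odot>\<^bsub>W\<^esub> f y))"

definition can_be_cast_into :: "'p program \<Rightarrow> 'q program \<Rightarrow> bool" where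
  "can_be_cast_into P Q \<longleftrightarrow> (\<exists>\<pi>. affine_map (var_space Q) (var_space P) \<pi> \<and>
    \<pi> ` feasible Q = feasible P \<and>
    (\<forall>v\<in>feasible Q. objective P (\<pi> v) = objective Q v))"


section \<open>Second-order cone programs\<close>

definition l2_norm_vec :: "real vec \<Rightarrow> real" where
  "l2_norm_vec v = sqrt (\<Sum>i<dim_vec v. (v $ i)\<^sup>2)"

definition socp ::
  "nat \<Rightarrow> real vec \<Rightarrow> nat \<Rightarrow> (nat \<Rightarrow> real mat) \<Rightarrow> (nat \<Rightarrow> real vec) \<Rightarrow> (nat \<Rightarrow> real vec) \<Rightarrow>
    (nat \<Rightarrow> real) \<Rightarrow> real mat \<Rightarrow> real vec \<Rightarrow> real vec program" where
  "socp n a q A b c d B e = \<lparr>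
    var_space = module_vec TYPE(real) n,
    feasible = {x \<in> carrier_vec n.
      (\<forall>i\<in>{1..q}. l2_norm_vec (A i *\<^sub>v x + b i) \<le> c i \<bullet> x + d i) \<and> B *\<^sub>v x = e},
    objective = (\<lambda>x. a \<bullet> x)\<rparr>"

text \<open>The numbers of rows of the \<open>A i\<close> and of \<open>B\<close> are arbitrary, possibly \<open>0\<close>.\<close>

definition is_socp :: "real vec program \<Rightarrow> bool" where
  "is_socp P \<longleftrightarrow> (\<exists>n a q A b c d B e.
    a \<in> carrier_vec n \<and>
    (\<forall>i\<in>{1..q}. A i \<in> carrier_mat (dim_vec (b i)) n \<and> c i \<in> carrier_vec n) \<and>
    B \<in> carrier_mat (dim_vec e) n \<and>
    P = socp n a q A b c d B e)"


section \<open>The cone of symmetric scaled diagonally dominant matrices\<close>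

definition sym_mats :: "nat \<Rightarrow> real mat set" where
  "sym_mats d = {A \<in> carrier_mat d d. transpose_mat A = A}"

definition sym_space :: "nat \<Rightarrow> (real, real mat) module" where
  "sym_space d = (module_mat TYPE(real) d d)\<lparr>carrier := sym_mats d\<rparr>"

definition psd_mats :: "nat \<Rightarrow> real mat set" where
  "psd_mats d = {A \<in> sym_mats d. \<forall>v\<in>carrier_vec d. 0 \<le> v \<bullet> (A *\<^sub>v v)}"

text \<open>
  For \<open>i < j\<close>, row (and column) \<open>0\<close> of \<open>M\<close> goes to position \<open>i\<close> and row \<open>1\<close> to position \<open>j\<close>.
\<close>

definition lift2 :: "nat \<Rightarrow> nat \<Rightarrow> nat \<Rightarrow> real mat \<Rightarrow> real mat" where
  "lift2 d i j M = mat d d (\<lambda>(k, l).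
    if k \<in> {i, j} \<and> l \<in> {i, j}
    then M $$ (if k = i then 0 else 1, if l = i then 0 else 1) else 0)"

definition sdd_cone :: "nat \<Rightarrow> real mat set" where
  "sdd_cone d =
    {finsum (sym_space d) (\<lambda>(i, j). lift2 d i j (M i j)) {(i, j). i < j \<and> j < d} | M.
      \<forall>i j. i < j \<and> j < d \<longrightarrow> M i j \<in> psd_mats 2}"


section \<open>SDD programs\<close>

definition trace_mat :: "real mat \<Rightarrow> real" where
  "trace_mat A = (\<Sum>i<dim_row A. A $$ (i, i))"

definition sdd_standard ::
  "nat \<Rightarrow> nat \<Rightarrow> (nat \<Rightarrow> real mat) \<Rightarrow> (nat \<Rightarrow> real) \<Rightarrow> real mat program" where
  "sdd_standard d p A b = \<lparr>
    var_space = sym_space d,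
    feasible = {X \<in> sym_mats d. (\<forall>i\<in>{1..p}. trace_mat (A i * X) = b i) \<and> X \<in> sdd_cone d},
    objective = (\<lambda>X. trace_mat (A 0 * X))\<rparr>"

definition is_sdd_standard :: "real mat program \<Rightarrow> bool" where
  "is_sdd_standard P \<longleftrightarrow> (\<exists>d p A b. 2 \<le> d \<and> (\<forall>i\<in>{0..p}. A i \<in> sym_mats d) \<and>
    P = sdd_standard d p A b)"

text \<open>The coordinates of \<open>x\<close> are numbered from \<open>0\<close>, so \<open>x $ (i - 1)\<close> is the coefficient of \<open>P i\<close>.\<close>

definition sdd_inequality ::
  "nat \<Rightarrow> nat \<Rightarrow> real vec \<Rightarrow> (nat \<Rightarrow> real mat) \<Rightarrow> real vec program" where
  "sdd_inequality d n q P = \<lparr>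
    var_space = module_vec TYPE(real) n,
    feasible = {x \<in> carrier_vec n.
      finsum (sym_space d) (\<lambda>i. x $ (i - 1) \<cdot>\<^sub>m P i) {1..n} + P 0 \<in> sdd_cone d},
    objective = (\<lambda>x. q \<bullet> x)\<rparr>"

definition is_sdd_inequality :: "real vec program \<Rightarrow> bool" where
  "is_sdd_inequality R \<longleftrightarrow> (\<exists>d n q P. 2 \<le> d \<and> q \<in> carrier_vec n \<and>
    (\<forall>i\<in>{0..n}. P i \<in> sym_mats d) \<and> R = sdd_inequality d n q P)"

end

theory Submission
  imports Defs
begin

text \<open>
  A positive semidefinite \<open>2 \<times> 2\<close> matrix with diagonal \<open>a, c\<close> and off-diagonal entry \<open>b\<close> is given by
  \<open>a, c \<ge> 0\<close> and \<open>b\<^sup>2 \<le> a * c\<close>. In a sum of lifted matrices \<open>M i j\<close>, an off-diagonal entry comes from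
  a single summand, while a diagonal entry collects one contribution from every pair that contains
  its index. So a symmetric \<open>X\<close> lies in the cone iff each diagonal entry \<open>X\<^sub>i\<^sub>i\<close> can be
  distributed into weights \<open>W i j \<ge> 0\<close> (\<open>j \<noteq> i\<close>) such that \<open>X\<^sub>i\<^sub>j\<^sup>2 \<le> W i j * W j i\<close>
  (\<open>sdd_cone_iff_weights\<close>). Both casts rest on this description.

  From an SDD program to an SOCP: the weights become additional variables. The conditions on
  \<open>X\<^sub>i\<^sub>i\<close> are linear equations, and the condition on \<open>X\<^sub>i\<^sub>j\<close> is a rotated second-order cone, that is,
  \<open>\<parallel>(2 * X\<^sub>i\<^sub>j, W i j - W j i)\<parallel> \<le> W i j + W j i\<close> (\<open>rotated_cone_iff_norm\<close>). Forgetting the weights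
  maps the feasible set of this SOCP onto that of the SDD program
  (\<open>sdd_system_can_be_cast_into_socp\<close>). In standard form the matrix variable is parametrised by
  a vector of its entries.

  From an SOCP to an SDD program in inequality form no additional variables occur: the constraint
  \<open>\<parallel>u\<parallel> \<le> t\<close> says exactly that the arrow matrix with constant diagonal \<open>t\<close> and first row \<open>(t, u)\<close>,
  extended by a zero row and column, is in the cone (\<open>arrow_mat_in_sdd_cone_iff\<close>). The weights are \<open>u\<^sub>k\<^sup>2 / t\<close> in the first row and \<open>t\<close>
  in the first column, and they fit into the diagonal iff \<open>\<Sum> u\<^sub>k\<^sup>2 / t \<le> t\<close>. Several constraints
  are imposed together by a block diagonal matrix (\<open>block_diag_in_sdd_cone_iff\<close>), and an equation
  \<open>g x = 0\<close> is the norm constraint \<open>\<bar>g x\<bar> \<le> 0\<close>. The entries of the resulting matrix are affine in \<open>x\<close>,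
  so the SOCP is itself an SDD program and the identity is the cast.
\<close>

section \<open>Symmetric matrices\<close>

lemma abelian_monoid_sym_space: "abelian_monoid (sym_space d)"
  by (rule abelian_monoidI)
     (auto simp: sym_space_def module_mat_def sym_mats_def transpose_add comm_add_mat)

lemma finsum_sym_space:
  assumes "finite A" "\<And>a. a \<in> A \<Longrightarrow> f a \<in> sym_mats d"
  shows "finsum (sym_space d) f A = mat d d (\<lambda>ij. \<Sum>a\<in>A. f a $$ ij)"
  using assms
proof (induction A rule: finite_induct)
  case empty
  interpret abelian_monoid "sym_space d" by (rule abelian_monoid_sym_space)
  have "\<zero>\<^bsub>sym_space d\<^esub> = 0\<^sub>m d d" by (simp add: sym_space_def module_mat_def)
  then show ?case by (auto simp: zero_mat_def)
next
  case (insert a A)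
  interpret abelian_monoid "sym_space d" by (rule abelian_monoid_sym_space)
  have f: "f \<in> A \<rightarrow> carrier (sym_space d)" "f a \<in> carrier (sym_space d)"
    using insert by (auto simp: sym_space_def)
  have "f a \<in> carrier_mat d d" using insert by (auto simp: sym_mats_def)
  then show ?case using insert finsum_insert[OF insert(1,2) f]
    by (auto simp: sym_space_def module_mat_def)
qed

lemma sym_mats_index:
  assumes "A \<in> sym_mats d" "i < d" "j < d"
  shows "A $$ (i, j) = A $$ (j, i)"
proof -
  have "A \<in> carrier_mat d d" "transpose_mat A $$ (i, j) = A $$ (i, j)"
    using assms(1) by (auto simp: sym_mats_def)
  then show ?thesis using assms(2,3) by (metis carrier_matD index_transpose_mat(1))
qed

lemma sym_matsI:
  assumes "A \<in> carrier_mat d d" "\<And>i j. i < d \<Longrightarrow> j < d \<Longrightarrow> A $$ (i, j) = A $$ (j, i)"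
  shows "A \<in> sym_mats d"
  unfolding sym_mats_def using assms by (intro CollectI conjI eq_matI) auto

lemma sym_mats_carrier: "A \<in> sym_mats d \<Longrightarrow> A \<in> carrier_mat d d"
  by (simp add: sym_mats_def)

lemma smult_in_sym_mats: "A \<in> sym_mats d \<Longrightarrow> t \<cdot>\<^sub>m A \<in> sym_mats d"
  using sym_mats_carrier[of A d] sym_mats_index[of A d] by (intro sym_matsI) auto

lemma diff_in_sym_mats: "A \<in> sym_mats d \<Longrightarrow> B \<in> sym_mats d \<Longrightarrow> A - B \<in> sym_mats d"
  using sym_mats_carrier[of A d] sym_mats_carrier[of B d] sym_mats_index[of A d] sym_mats_index[of B d]
  by (intro sym_matsI) auto

section \<open>The scaled diagonally dominant cone in terms of weights\<close>

text \<open>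
  The quadratic form \<open>a * x\<^sup>2 + 2 * b * x * y + c * y\<^sup>2\<close> is nonnegative iff \<open>a\<close>, \<open>c\<close> and the
  determinant \<open>a * c - b\<^sup>2\<close> are, by completing the square.
\<close>
lemma psd_mats_2_iff:
  "A \<in> psd_mats 2 \<longleftrightarrow> A \<in> sym_mats 2 \<and> 0 \<le> A $$ (0,0) \<and> 0 \<le> A $$ (1,1) \<and>
     (A $$ (0,1))\<^sup>2 \<le> A $$ (0,0) * A $$ (1,1)"
proof (cases "A \<in> sym_mats 2")
  case True
  have A: "A \<in> carrier_mat 2 2" using True by (rule sym_mats_carrier)
  have sym: "A $$ (1,0) = A $$ (0,1)" using sym_mats_index[OF True, of 1 0] by simp
  define a b c where "a = A $$ (0,0)" and "b = A $$ (0,1)" and "c = A $$ (1,1)"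
  have form: "v \<bullet> (A *\<^sub>v v) = a * (v $ 0)\<^sup>2 + 2 * b * (v $ 0) * (v $ 1) + c * (v $ 1)\<^sup>2"
    if "v \<in> carrier_vec 2" for v
  proof -
    have "v \<bullet> (A *\<^sub>v v) = (v $ 0) * (a * (v $ 0) + b * (v $ 1)) + (v $ 1) * (b * (v $ 0) + c * (v $ 1))"
      using that A sym
      by (simp add: scalar_prod_def a_def b_def c_def numeral_2_eq_2)
    then show ?thesis by (simp add: power2_eq_square algebra_simps)
  qed
  have vec: "\<exists>v\<in>carrier_vec 2. v $ 0 = x \<and> v $ 1 = y" for x y :: real
    by (rule bexI[of _ "vec 2 (\<lambda>i. if i = 0 then x else y)"]) auto
  have "(\<forall>v\<in>carrier_vec 2. 0 \<le> v \<bullet> (A *\<^sub>v v)) \<longleftrightarrow>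
      (\<forall>x y. 0 \<le> a * x\<^sup>2 + 2 * b * x * y + c * y\<^sup>2)"
    using form vec by metis
  also have "\<dots> \<longleftrightarrow> 0 \<le> a \<and> 0 \<le> c \<and> b\<^sup>2 \<le> a * c"
  proof (intro iffI conjI allI)
    assume *: "\<forall>x y. 0 \<le> a * x\<^sup>2 + 2 * b * x * y + c * y\<^sup>2"
    show a: "0 \<le> a" using *[rule_format, of 1 0] by simp
    show c: "0 \<le> c" using *[rule_format, of 0 1] by simp
    show "b\<^sup>2 \<le> a * c"
    proof (cases "a = 0")
      case False
      \<comment> \<open>For fixed \<open>y = -a\<close> the form is minimal at \<open>x = b\<close>.\<close>
      have "0 \<le> a * (a * c - b\<^sup>2)"
        using *[rule_format, of b "-a"] by (simp add: power2_eq_square algebra_simps)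
      then show ?thesis using a False by (simp add: zero_le_mult_iff)
    next
      case True
      have "0 \<le> 2 * b * x + c" for x
        using *[rule_format, of x 1] True by simp
      \<comment> \<open>An affine function bounded below is constant; if \<open>b \<noteq> 0\<close>, this point has the value \<open>-1\<close>.\<close>
      from this[of "- (c + 1) / (2 * b)"] have "b = 0" by (cases "b = 0") auto
      then show ?thesis using True by simp
    qed
  next
    fix x y assume *: "0 \<le> a \<and> 0 \<le> c \<and> b\<^sup>2 \<le> a * c"
    show "0 \<le> a * x\<^sup>2 + 2 * b * x * y + c * y\<^sup>2"
    proof (cases "a = 0")
      case True
      then show ?thesis using * by simp
    next
      case False
      have "a * (a * x\<^sup>2 + 2 * b * x * y + c * y\<^sup>2) = (a * x + b * y)\<^sup>2 + (a * c - b\<^sup>2) * y\<^sup>2"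
        by (simp add: power2_eq_square algebra_simps)
      also have "\<dots> \<ge> 0" using * by simp
      finally show ?thesis using * False by (simp add: zero_le_mult_iff)
    qed
  qed
  finally show ?thesis using True by (simp add: psd_mats_def a_def b_def c_def)
qed (simp add: psd_mats_def)

text \<open>
  The share \<open>W i j\<close> of the \<open>i\<close>-th diagonal entry and the share \<open>W j i\<close> of the \<open>j\<close>-th together
  dominate the off-diagonal entry at \<open>(i, j)\<close>: they form the diagonal of a positive semidefinite
  \<open>2 \<times> 2\<close> matrix that has this entry off the diagonal.
\<close>
definition dominating_weights :: "nat \<Rightarrow> real mat \<Rightarrow> (nat \<Rightarrow> nat \<Rightarrow> real) \<Rightarrow> bool" where
  "dominating_weights d X W \<longleftrightarrow>
    (\<forall>i<d. \<forall>j<d. i \<noteq> j \<longrightarrow> 0 \<le> W i j \<and> (X $$ (i, j))\<^sup>2 \<le> W i j * W j i)"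

lemma lift2_in_sym_mats:
  assumes "i < j" "M \<in> sym_mats 2" shows "lift2 d i j M \<in> sym_mats d"
  using assms(1) sym_mats_index[OF assms(2)] by (intro sym_matsI) (auto simp: lift2_def)

text \<open>
  The pairs that contain \<open>i\<close> correspond to the indices \<open>j \<noteq> i\<close>. Whether \<open>i\<close> takes position \<open>0\<close> or \<open>1\<close>
  in the \<open>2 \<times> 2\<close> matrix of the pair depends on the order of \<open>i\<close> and \<open>j\<close>.
\<close>
lemma sum_lift2_diag:
  assumes "i < d"
  shows "(\<Sum>(k, l)\<in>{(k, l). k < l \<and> l < d}. lift2 d k l (M k l) $$ (i, i)) =
    (\<Sum>j\<in>{..<d} - {i}. if i < j then M i j $$ (0, 0) else M j i $$ (1, 1))" (is "sum ?f ?P = sum ?w _")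
proof -
  have fin: "finite ?P" by (rule finite_subset[of _ "{..<d} \<times> {..<d}"]) auto
  have "sum ?f ?P = sum ?f ((\<lambda>j. (min i j, max i j)) ` ({..<d} - {i}))"
  proof (rule sum.mono_neutral_right[OF fin])
    show "\<forall>p\<in>?P - (\<lambda>j. (min i j, max i j)) ` ({..<d} - {i}). ?f p = 0"
    proof clarsimp
      fix k l assume *: "k < l" "l < d" "(k, l) \<notin> (\<lambda>j. (min i j, max i j)) ` ({..<d} - {i})"
      have "i \<noteq> k"
        using * image_eqI[of "(k, l)" "\<lambda>j. (min i j, max i j)" l "{..<d} - {i}"] by auto
      moreover have "i \<noteq> l"
        using * image_eqI[of "(k, l)" "\<lambda>j. (min i j, max i j)" k "{..<d} - {i}"] by auto
      ultimately show "lift2 d k l (M k l) $$ (i, i) = 0" using assms by (simp add: lift2_def)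
    qed
  qed (use assms in auto)
  also have "\<dots> = sum (?f \<circ> (\<lambda>j. (min i j, max i j))) ({..<d} - {i})"
    by (rule sum.reindex) (auto simp: inj_on_def min_def max_def split: if_splits)
  also have "\<dots> = sum ?w ({..<d} - {i})"
    by (rule sum.cong) (use assms in \<open>auto simp: lift2_def min_def max_def\<close>)
  finally show ?thesis .
qed

lemma sum_lift2_offdiag:
  assumes "i < j" "j < d"
  shows "(\<Sum>(k, l)\<in>{(k, l). k < l \<and> l < d}. lift2 d k l (M k l) $$ (i, j)) = M i j $$ (0, 1)"
proof -
  have fin: "finite {(k, l). k < l \<and> l < d}"
    by (rule finite_subset[of _ "{..<d} \<times> {..<d}"]) auto
  have "(\<Sum>(k, l)\<in>{(k, l). k < l \<and> l < d}. lift2 d k l (M k l) $$ (i, j)) =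
     (\<Sum>(k, l)\<in>{(i, j)}. lift2 d k l (M k l) $$ (i, j))"
    by (rule sum.mono_neutral_right[OF fin]) (use assms in \<open>auto simp: lift2_def split: if_splits\<close>)
  then show ?thesis using assms by (simp add: lift2_def)
qed

text \<open>
  Given a decomposition, \<open>W i j\<close> is the diagonal entry at the position of \<open>i\<close> of the matrix that
  belongs to the pair of \<open>i\<close> and \<open>j\<close>. Conversely the matrix of a pair is assembled from its two
  weights and the entry of \<open>X\<close>.
\<close>
lemma sdd_cone_iff_weights:
  "X \<in> sdd_cone d \<longleftrightarrow> X \<in> sym_mats d \<and>
    (\<exists>W. dominating_weights d X W \<and> (\<forall>i<d. (\<Sum>j\<in>{..<d} - {i}. W i j) = X $$ (i, i)))"
proof
  let ?P = "{(k, l). k < l \<and> l < d}"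
  have fin: "finite ?P" by (rule finite_subset[of _ "{..<d} \<times> {..<d}"]) auto
  {
    assume "X \<in> sdd_cone d"
    then obtain M where M: "\<And>i j. i < j \<Longrightarrow> j < d \<Longrightarrow> M i j \<in> psd_mats 2"
      and X: "X = finsum (sym_space d) (\<lambda>(i, j). lift2 d i j (M i j)) ?P"
      by (auto simp: sdd_cone_def)
    interpret abelian_monoid "sym_space d" by (rule abelian_monoid_sym_space)
    have lift: "lift2 d i j (M i j) \<in> sym_mats d" if "i < j" "j < d" for i j
      using M that by (intro lift2_in_sym_mats) (auto simp: psd_mats_2_iff)
    have "X \<in> carrier (sym_space d)"
      unfolding X using lift by (intro finsum_closed) (auto simp: sym_space_def)
    then have sym: "X \<in> sym_mats d" by (simp add: sym_space_def)
    have X': "X = mat d d (\<lambda>ij. \<Sum>(k, l)\<in>?P. lift2 d k l (M k l) $$ ij)"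
      unfolding X using lift by (subst finsum_sym_space[OF fin]) (auto simp: case_prod_beta)
    define W where "W i j = (if i < j then M i j $$ (0, 0) else M j i $$ (1, 1))" for i j
    have "X $$ (i, j) = M i j $$ (0, 1)" if "i < j" "j < d" for i j
      unfolding X' using that by (simp add: sum_lift2_offdiag)
    then have upper: "0 \<le> W i j \<and> 0 \<le> W j i \<and> (X $$ (i, j))\<^sup>2 \<le> W i j * W j i"
      if "i < j" "j < d" for i j
      using M[OF that] that by (auto simp: W_def psd_mats_2_iff)
    have "dominating_weights d X W"
      unfolding dominating_weights_def
    proof (intro allI impI)
      fix i j assume ij: "i < d" "j < d" "i \<noteq> j"
      then consider "i < j" | "j < i" by linarith
      then show "0 \<le> W i j \<and> (X $$ (i, j))\<^sup>2 \<le> W i j * W j i"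
        using upper[of i j] upper[of j i] ij sym_mats_index[OF sym ij(1,2)]
        by cases (auto simp: mult.commute)
    qed
    moreover have "(\<Sum>j\<in>{..<d} - {i}. W i j) = X $$ (i, i)" if "i < d" for i
      unfolding X' W_def using that by (simp add: sum_lift2_diag)
    ultimately show "X \<in> sym_mats d \<and> (\<exists>W. dominating_weights d X W \<and>
      (\<forall>i<d. (\<Sum>j\<in>{..<d} - {i}. W i j) = X $$ (i, i)))" using sym by blast
  next
    assume "X \<in> sym_mats d \<and> (\<exists>W. dominating_weights d X W \<and>
      (\<forall>i<d. (\<Sum>j\<in>{..<d} - {i}. W i j) = X $$ (i, i)))"
    then obtain W where sym: "X \<in> sym_mats d" and W: "dominating_weights d X W"
      and diag: "\<And>i. i < d \<Longrightarrow> (\<Sum>j\<in>{..<d} - {i}. W i j) = X $$ (i, i)" by blast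
    define M where "M i j = mat 2 2 (\<lambda>(k, l). if k = l then if k = 0 then W i j else W j i
      else X $$ (i, j))" for i j
    have psd: "M i j \<in> psd_mats 2" if "i < j" "j < d" for i j
    proof -
      have "M i j \<in> sym_mats 2" by (rule sym_matsI) (auto simp: M_def)
      then show ?thesis
        using that W by (auto simp: psd_mats_2_iff M_def dominating_weights_def)
    qed
    have lift: "lift2 d i j (M i j) \<in> sym_mats d" if "i < j" "j < d" for i j
      using psd that by (intro lift2_in_sym_mats) (auto simp: psd_mats_2_iff)
    have "X = mat d d (\<lambda>ij. \<Sum>(k, l)\<in>?P. lift2 d k l (M k l) $$ ij)" (is "X = ?Z")
    proof (rule eq_matI)
      fix i j assume "i < dim_row ?Z" "j < dim_col ?Z"
      then have ij: "i < d" "j < d" by auto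
      have upper: "X $$ (i, j) = ?Z $$ (i, j)" if "i < j" "j < d" for i j
        using that by (simp add: sum_lift2_offdiag M_def)
      have Z: "?Z \<in> sym_mats d"
        using sym_mats_index[OF lift]
        by (intro sym_matsI) (auto intro!: sum.cong)
      consider "i < j" | "j < i" | "i = j" by linarith
      then show "X $$ (i, j) = ?Z $$ (i, j)"
      proof cases
        case 1
        then show ?thesis using upper ij by blast
      next
        case 2
        then show ?thesis
          using upper[of j i] ij sym_mats_index[OF sym ij] sym_mats_index[OF Z ij] by simp
      next
        case 3
        have "?Z $$ (i, i) = (\<Sum>j\<in>{..<d} - {i}. if i < j then M i j $$ (0, 0) else M j i $$ (1, 1))"
          using ij by (simp add: sum_lift2_diag)
        also have "\<dots> = (\<Sum>j\<in>{..<d} - {i}. W i j)"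
          by (rule sum.cong) (auto simp: M_def)
        finally show ?thesis using 3 diag ij by simp
      qed
    qed (use sym_mats_carrier[OF sym] in auto)
    also have "\<dots> = finsum (sym_space d) (\<lambda>(i, j). lift2 d i j (M i j)) ?P"
      using lift by (subst finsum_sym_space[OF fin]) (auto simp: case_prod_beta)
    finally show "X \<in> sdd_cone d" using psd unfolding sdd_cone_def by blast
  }
qed

text \<open>
  It suffices to spend at most the diagonal: what remains of row \<open>i\<close> can be added to any weight
  \<open>W i j\<close> with \<open>j \<noteq> i\<close>, since enlarging weights preserves domination. Such a \<open>j\<close> exists once \<open>d \<ge> 2\<close>.
  In dimension \<open>1\<close> the sums are empty, so the bounds would admit every nonnegative entry whereas the
  cone contains only \<open>0\<close>.
\<close>
lemma sdd_cone_iff_subweights: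
  assumes "2 \<le> d"
  shows "X \<in> sdd_cone d \<longleftrightarrow> X \<in> sym_mats d \<and>
    (\<exists>W. dominating_weights d X W \<and> (\<forall>i<d. (\<Sum>j\<in>{..<d} - {i}. W i j) \<le> X $$ (i, i)))"
proof
  assume "X \<in> sdd_cone d"
  then show "X \<in> sym_mats d \<and>
    (\<exists>W. dominating_weights d X W \<and> (\<forall>i<d. (\<Sum>j\<in>{..<d} - {i}. W i j) \<le> X $$ (i, i)))"
    unfolding sdd_cone_iff_weights by (metis order_refl)
next
  assume "X \<in> sym_mats d \<and>
    (\<exists>W. dominating_weights d X W \<and> (\<forall>i<d. (\<Sum>j\<in>{..<d} - {i}. W i j) \<le> X $$ (i, i)))"
  then obtain W where sym: "X \<in> sym_mats d" and W: "dominating_weights d X W"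
    and diag: "\<And>i. i < d \<Longrightarrow> (\<Sum>j\<in>{..<d} - {i}. W i j) \<le> X $$ (i, i)" by blast
  define \<sigma> :: "nat \<Rightarrow> nat" where "\<sigma> i = (if i = 0 then 1 else 0)" for i
  have \<sigma>: "\<sigma> i < d" "\<sigma> i \<noteq> i" for i using assms by (auto simp: \<sigma>_def)
  define s where "s i = X $$ (i, i) - (\<Sum>j\<in>{..<d} - {i}. W i j)" for i
  define V where "V i j = W i j + (if j = \<sigma> i then s i else 0)" for i j
  have VW: "W i j \<le> V i j" if "i < d" for i j using diag[OF that] by (auto simp: V_def s_def)
  have "dominating_weights d X V"
    unfolding dominating_weights_def
  proof (intro allI impI)
    fix i j assume ij: "i < d" "j < d" "i \<noteq> j"
    then have W': "0 \<le> W i j" "0 \<le> W j i" "(X $$ (i, j))\<^sup>2 \<le> W i j * W j i"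
      using W by (auto simp: dominating_weights_def)
    moreover have "W i j * W j i \<le> V i j * V j i"
      using W' VW[of i j] VW[of j i] ij by (intro mult_mono) auto
    ultimately show "0 \<le> V i j \<and> (X $$ (i, j))\<^sup>2 \<le> V i j * V j i"
      using VW[of i j] ij by linarith
  qed
  moreover have "(\<Sum>j\<in>{..<d} - {i}. V i j) = X $$ (i, i)" if "i < d" for i
  proof -
    have "(\<Sum>j\<in>{..<d} - {i}. if j = \<sigma> i then s i else 0) = s i"
      using \<sigma> by (subst sum.delta) auto
    then show ?thesis by (simp add: V_def sum.distrib s_def)
  qed
  ultimately show "X \<in> sdd_cone d" using sym unfolding sdd_cone_iff_weights by blast
qed

section \<open>Affine functionals\<close>

text \<open>
  Only the values on the carrier count, because entries of vectors beyond their dimension are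
  unspecified.
\<close>
definition affine_functional :: "nat \<Rightarrow> (real vec \<Rightarrow> real) \<Rightarrow> bool" where
  "affine_functional n f \<longleftrightarrow>
    (\<exists>c k. \<forall>x\<in>carrier_vec n. f x = (\<Sum>i<n. c i * x $ i) + k)"

lemma affine_functional_cong:
  "(\<And>x. x \<in> carrier_vec n \<Longrightarrow> f x = g x) \<Longrightarrow> affine_functional n f \<longleftrightarrow> affine_functional n g"
  by (simp add: affine_functional_def)

lemma affine_functional_const [intro]: "affine_functional n (\<lambda>x. k)"
  unfolding affine_functional_def by (intro exI[of _ "\<lambda>i. 0"] exI[of _ k]) simp

lemma affine_functional_coord [intro]:
  assumes "i < n" shows "affine_functional n (\<lambda>x. x $ i)"
proof -
  have "(\<Sum>j<n. (if j = i then 1 else 0) * x $ j) = (\<Sum>j<n. if j = i then x $ j else 0)" for x :: "real vec"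
    by (rule sum.cong) auto
  then have "x $ i = (\<Sum>j<n. (if j = i then 1 else 0) * x $ j) + 0" for x :: "real vec"
    using assms by simp
  then show ?thesis
    unfolding affine_functional_def by (intro exI[of _ "\<lambda>j. if j = i then 1 else 0"] exI[of _ 0] ballI)
qed

lemma affine_functional_add [intro]:
  assumes "affine_functional n f" "affine_functional n g"
  shows "affine_functional n (\<lambda>x. f x + g x)"
proof -
  obtain c k c' k' where "\<forall>x\<in>carrier_vec n. f x = (\<Sum>i<n. c i * x $ i) + k"
    "\<forall>x\<in>carrier_vec n. g x = (\<Sum>i<n. c' i * x $ i) + k'"
    using assms by (auto simp: affine_functional_def)
  then show ?thesis unfolding affine_functional_def
    by (intro exI[of _ "\<lambda>i. c i + c' i"] exI[of _ "k + k'"]) (simp add: algebra_simps sum.distrib)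
qed

lemma affine_functional_cmult [intro]:
  assumes "affine_functional n f"
  shows "affine_functional n (\<lambda>x. r * f x)"
proof -
  obtain c k where "\<forall>x\<in>carrier_vec n. f x = (\<Sum>i<n. c i * x $ i) + k"
    using assms by (auto simp: affine_functional_def)
  then show ?thesis unfolding affine_functional_def
    by (intro exI[of _ "\<lambda>i. r * c i"] exI[of _ "r * k"]) (simp add: algebra_simps sum_distrib_left)
qed

lemma affine_functional_diff [intro]:
  assumes "affine_functional n f" "affine_functional n g"
  shows "affine_functional n (\<lambda>x. f x - g x)"
  using affine_functional_add[OF assms(1) affine_functional_cmult[OF assms(2), of "-1"]] by simp

lemma affine_functional_sum [intro]:
  assumes "\<And>a. a \<in> A \<Longrightarrow> affine_functional n (f a)"
  shows "affine_functional n (\<lambda>x. \<Sum>a\<in>A. f a x)"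
  using assms by (induction A rule: infinite_finite_induct) auto

lemma affine_functional_if [intro]:
  assumes "b \<Longrightarrow> affine_functional n f" "\<not> b \<Longrightarrow> affine_functional n g"
  shows "affine_functional n (\<lambda>x. if b then f x else g x)"
  using assms by (cases b) auto

lemmas affine_functional_intros = affine_functional_if affine_functional_const affine_functional_coord
  affine_functional_add affine_functional_diff affine_functional_cmult affine_functional_sum

lemma affine_functional_vec_first:
  assumes "affine_functional m f"
  shows "affine_functional (m + k) (\<lambda>v. f (vec_first v m))"
proof -
  obtain c l where "\<forall>x\<in>carrier_vec m. f x = (\<Sum>i<m. c i * x $ i) + l"
    using assms by (auto simp: affine_functional_def)
  then have "f (vec_first v m) = (\<Sum>i<m. c i * v $ i) + l" for v
    by (simp add: vec_first_def)
  moreover have "affine_functional (m + k) (\<lambda>v. (\<Sum>i<m. c i * v $ i) + l)"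
    by (intro affine_functional_intros) auto
  ultimately show ?thesis by simp
qed

lemma affine_functional_scalar_prod:
  assumes "c \<in> carrier_vec n" shows "affine_functional n (\<lambda>x. c \<bullet> x)"
proof -
  have "affine_functional n (\<lambda>x. \<Sum>i<n. c $ i * x $ i)"
    by (intro affine_functional_intros) auto
  then show ?thesis
    by (rule affine_functional_cong[THEN iffD1, rotated]) (simp add: scalar_prod_def lessThan_atLeast0)
qed

definition gradient :: "nat \<Rightarrow> (real vec \<Rightarrow> real) \<Rightarrow> real vec" where
  "gradient n f = vec n (\<lambda>i. f (unit_vec n i) - f (0\<^sub>v n))"

lemma gradient_carrier [simp]: "gradient n f \<in> carrier_vec n"
  by (simp add: gradient_def)

text \<open>
  The coefficients of an affine functional can be read off from its values at the origin and the unit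
  vectors. This turns functionals back into the coefficient vectors and matrices of a program.
\<close>
lemma affine_functional_expand:
  assumes "affine_functional n f" "x \<in> carrier_vec n"
  shows "f x = (\<Sum>i<n. gradient n f $ i * x $ i) + f (0\<^sub>v n)"
proof -
  obtain c k where f: "\<forall>x\<in>carrier_vec n. f x = (\<Sum>i<n. c i * x $ i) + k"
    using assms by (auto simp: affine_functional_def)
  have "f (0\<^sub>v n) = k" using f by simp
  moreover have "f (unit_vec n i) = c i + k" if "i < n" for i
  proof -
    have "(\<Sum>j<n. c j * unit_vec n i $ j) = (\<Sum>j<n. if j = i then c j else 0)"
      using that by (intro sum.cong) auto
    then show ?thesis using f that by simp
  qed
  ultimately show ?thesis using f assms(2) by (simp add: gradient_def)
qed

lemma affine_functional_eq_gradient: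
  assumes "affine_functional n f" "x \<in> carrier_vec n"
  shows "f x = gradient n f \<bullet> x + f (0\<^sub>v n)"
  using affine_functional_expand[OF assms] assms(2) by (simp add: scalar_prod_def lessThan_atLeast0)

section \<open>Second-order cone programs as systems of norm constraints\<close>

text \<open>
  A pair \<open>(us, t)\<close> stands for the constraint that the Euclidean norm of the vector of values of \<open>us\<close>
  is at most \<open>t\<close>. With constraints as functionals in a set, systems are joined by union and need no
  numbering, and \<open>([g], 0)\<close> expresses the equation \<open>g = 0\<close>.
\<close>
type_synonym norm_cone = "(real vec \<Rightarrow> real) list \<times> (real vec \<Rightarrow> real)"

definition norm_cone_set :: "nat \<Rightarrow> norm_cone set \<Rightarrow> real vec set" where
  "norm_cone_set n C = {x \<in> carrier_vec n. \<forall>(us, t)\<in>C. sqrt (\<Sum>u\<leftarrow>us. (u x)\<^sup>2) \<le> t x}"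

definition affine_norm_cones :: "nat \<Rightarrow> norm_cone set \<Rightarrow> bool" where
  "affine_norm_cones n C \<longleftrightarrow> finite C \<and>
    (\<forall>(us, t)\<in>C. (\<forall>u\<in>set us. affine_functional n u) \<and> affine_functional n t)"

text \<open>
  The matrices of the SOCP have the gradients of the functionals as rows. The system \<open>B x = e\<close> is empty,
  as equations among the constraints already take the form of norm constraints with bound \<open>0\<close>.
  An SOCP has no constant term in its objective, whence the condition at the origin.
\<close>
lemma socp_of_norm_cones:
  assumes C: "affine_norm_cones n C" and f: "affine_functional n f" "f (0\<^sub>v n) = 0"
  obtains Q where "is_socp Q" "var_space Q = module_vec TYPE(real) n"
    "feasible Q = norm_cone_set n C" "\<And>x. x \<in> carrier_vec n \<Longrightarrow> objective Q x = f x"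
proof -
  have "finite C" using C by (simp add: affine_norm_cones_def)
  then obtain h where h: "bij_betw h {1..card C} C" using ex_bij_betw_nat_finite_1 by blast
  define us t where "us i = fst (h i)" and "t i = snd (h i)" for i
  define A where "A i = mat (length (us i)) n (\<lambda>(k, j). gradient n (us i ! k) $ j)" for i
  define b where "b i = vec (length (us i)) (\<lambda>k. (us i ! k) (0\<^sub>v n))" for i
  let ?Q = "socp n (gradient n f) (card C) A b (\<lambda>i. gradient n (t i)) (\<lambda>i. t i (0\<^sub>v n)) (0\<^sub>m 0 n) (0\<^sub>v 0)"
  have aff: "affine_functional n (t i)" "\<And>k. k < length (us i) \<Longrightarrow> affine_functional n (us i ! k)"
    if "i \<in> {1..card C}" for i
  proof -
    have "(us i, t i) \<in> C" using bij_betwE[OF h] that by (simp add: us_def t_def)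
    then show "affine_functional n (t i)" "\<And>k. k < length (us i) \<Longrightarrow> affine_functional n (us i ! k)"
      using C by (auto simp: affine_norm_cones_def)
  qed
  have norm: "l2_norm_vec (A i *\<^sub>v x + b i) = sqrt (\<Sum>u\<leftarrow>us i. (u x)\<^sup>2)"
    if "i \<in> {1..card C}" "x \<in> carrier_vec n" for i x
  proof -
    have "(A i *\<^sub>v x + b i) $ k = (us i ! k) x" if "k < length (us i)" for k
      using affine_functional_expand[OF aff(2)[OF \<open>i \<in> _\<close> that] \<open>x \<in> _\<close>] that \<open>x \<in> _\<close>
      by (simp add: A_def b_def scalar_prod_def lessThan_atLeast0)
    then show ?thesis
      by (simp add: l2_norm_vec_def sum_list_sum_nth lessThan_atLeast0 b_def)
  qed
  have "is_socp ?Q"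
    unfolding is_socp_def
    by (intro exI conjI) (auto simp: A_def b_def)
  moreover have "var_space ?Q = module_vec TYPE(real) n" by (simp add: socp_def)
  moreover have "feasible ?Q = norm_cone_set n C"
  proof -
    have "(\<forall>i\<in>{1..card C}. l2_norm_vec (A i *\<^sub>v x + b i) \<le> gradient n (t i) \<bullet> x + t i (0\<^sub>v n)) \<longleftrightarrow>
        (\<forall>(us, t)\<in>C. sqrt (\<Sum>u\<leftarrow>us. (u x)\<^sup>2) \<le> t x)" if x: "x \<in> carrier_vec n" for x
    proof -
      have "(\<forall>i\<in>{1..card C}. l2_norm_vec (A i *\<^sub>v x + b i) \<le> gradient n (t i) \<bullet> x + t i (0\<^sub>v n)) \<longleftrightarrow>
          (\<forall>i\<in>{1..card C}. sqrt (\<Sum>u\<leftarrow>fst (h i). (u x)\<^sup>2) \<le> snd (h i) x)"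
        using norm[OF _ x] affine_functional_eq_gradient[OF aff(1) x] by (auto simp: us_def t_def)
      also have "\<dots> \<longleftrightarrow> (\<forall>p\<in>h ` {1..card C}. sqrt (\<Sum>u\<leftarrow>fst p. (u x)\<^sup>2) \<le> snd p x)"
        by (simp only: ball_simps)
      also have "h ` {1..card C} = C" by (rule bij_betw_imp_surj_on[OF h])
      finally show ?thesis by (simp add: case_prod_beta)
    qed
    then show ?thesis by (auto simp: socp_def norm_cone_set_def intro!: eq_vecI)
  qed
  moreover have "objective ?Q x = f x" if "x \<in> carrier_vec n" for x
    using affine_functional_eq_gradient[OF f(1) that] f(2) by (simp add: socp_def)
  ultimately show ?thesis by (rule that)
qed

lemma affine_functional_mult_mat_vec:
  assumes "A \<in> carrier_mat r n" "k < r" shows "affine_functional n (\<lambda>x. (A *\<^sub>v x) $ k)"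
proof -
  have "affine_functional n (\<lambda>x. row A k \<bullet> x)"
    using assms by (intro affine_functional_scalar_prod) auto
  then show ?thesis using assms by simp
qed

text \<open>
  Each norm constraint contributes the rows of \<open>A i x + b i\<close>, and each row of \<open>B x = e\<close> becomes a norm
  constraint with bound \<open>0\<close>.
\<close>
lemma norm_cones_of_socp:
  assumes "is_socp P"
  obtains n a C where "a \<in> carrier_vec n" "affine_norm_cones n C"
    "P = \<lparr>var_space = module_vec TYPE(real) n, feasible = norm_cone_set n C, objective = (\<lambda>x. a \<bullet> x)\<rparr>"
proof -
  obtain n a q A b c d B e where a: "a \<in> carrier_vec n"
    and Ac: "\<And>i. i \<in> {1..q} \<Longrightarrow> A i \<in> carrier_mat (dim_vec (b i)) n \<and> c i \<in> carrier_vec n"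
    and B: "B \<in> carrier_mat (dim_vec e) n" and P: "P = socp n a q A b c d B e"
    using assms unfolding is_socp_def by blast
  define C\<^sub>1 where "C\<^sub>1 = (\<lambda>i. (map (\<lambda>k x. (A i *\<^sub>v x) $ k + b i $ k) [0..<dim_vec (b i)],
    \<lambda>x. c i \<bullet> x + d i)) ` {1..q}"
  define C\<^sub>2 where "C\<^sub>2 = (\<lambda>j. ([\<lambda>x. (B *\<^sub>v x) $ j - e $ j], \<lambda>x :: real vec. 0 :: real)) ` {..<dim_vec e}"
  have "affine_norm_cones n (C\<^sub>1 \<union> C\<^sub>2)"
    using Ac B unfolding affine_norm_cones_def C\<^sub>1_def C\<^sub>2_def
    by (auto intro!: affine_functional_add affine_functional_diff affine_functional_scalar_prod
        affine_functional_const affine_functional_mult_mat_vec[OF conjunct1[OF Ac]]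
        affine_functional_mult_mat_vec[OF B])
  moreover have "feasible P = norm_cone_set n (C\<^sub>1 \<union> C\<^sub>2)"
  proof -
    have "(\<forall>(us, t)\<in>C\<^sub>1. sqrt (\<Sum>u\<leftarrow>us. (u x)\<^sup>2) \<le> t x) \<longleftrightarrow>
        (\<forall>i\<in>{1..q}. l2_norm_vec (A i *\<^sub>v x + b i) \<le> c i \<bullet> x + d i)" for x
    proof -
      have "sqrt (\<Sum>k\<leftarrow>[0..<dim_vec (b i)]. ((A i *\<^sub>v x) $ k + b i $ k)\<^sup>2) = l2_norm_vec (A i *\<^sub>v x + b i)"
        if "i \<in> {1..q}" for i
        using Ac[OF that]
        by (auto simp: l2_norm_vec_def interv_sum_list_conv_sum_set_nat lessThan_atLeast0 intro!: sum.cong)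
      then show ?thesis by (simp add: C\<^sub>1_def o_def)
    qed
    moreover have "(\<forall>(us, t)\<in>C\<^sub>2. sqrt (\<Sum>u\<leftarrow>us. (u x)\<^sup>2) \<le> t x) \<longleftrightarrow> B *\<^sub>v x = e"
      if "x \<in> carrier_vec n" for x
      using B by (auto simp: C\<^sub>2_def vec_eq_iff)
    ultimately show ?thesis
      by (simp add: P socp_def norm_cone_set_def ball_Un cong: conj_cong)
  qed
  ultimately show ?thesis using that[OF a] by (simp add: P socp_def)
qed

section \<open>Sets cut out by an affine matrix inequality over the cone\<close>

definition affine_sym_map :: "nat \<Rightarrow> nat \<Rightarrow> (real vec \<Rightarrow> real mat) \<Rightarrow> bool" where
  "affine_sym_map n d S \<longleftrightarrow> (\<forall>x\<in>carrier_vec n. S x \<in> sym_mats d) \<and>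
    (\<forall>i<d. \<forall>j<d. affine_functional n (\<lambda>x. S x $$ (i, j)))"

definition sdd_representable :: "nat \<Rightarrow> real vec set \<Rightarrow> bool" where
  "sdd_representable n F \<longleftrightarrow>
    (\<exists>d S. 2 \<le> d \<and> affine_sym_map n d S \<and> F = {x \<in> carrier_vec n. S x \<in> sdd_cone d})"

lemma sdd_representable_carrier: "sdd_representable n (carrier_vec n)"
proof -
  have sym: "0\<^sub>m 2 2 \<in> sym_mats 2" by (rule sym_matsI) auto
  have "(0\<^sub>m 2 2 :: real mat) \<in> sdd_cone 2"
    unfolding sdd_cone_iff_weights dominating_weights_def
    by (intro conjI sym exI[of _ "\<lambda>i j. 0"]) auto
  then show ?thesis
    unfolding sdd_representable_def affine_sym_map_def
    by (intro exI[of _ 2] exI[of _ "\<lambda>x. 0\<^sub>m 2 2"]) (auto simp: sym intro: affine_functional_const)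
qed

definition block_diag :: "real mat \<Rightarrow> real mat \<Rightarrow> real mat" where
  "block_diag A B = four_block_mat A (0\<^sub>m (dim_row A) (dim_col B)) (0\<^sub>m (dim_row B) (dim_col A)) B"

lemma block_diag_in_sym_mats:
  assumes "A \<in> sym_mats d" "B \<in> sym_mats e"
  shows "block_diag A B \<in> sym_mats (d + e)"
  using sym_mats_carrier[OF assms(1)] sym_mats_carrier[OF assms(2)]
    sym_mats_index[OF assms(1)] sym_mats_index[OF assms(2)]
  by (intro sym_matsI) (auto simp: block_diag_def)

text \<open>
  Weights for the two blocks extend by \<open>0\<close>, as the entries outside the blocks vanish. Conversely,
  restricting weights of the whole matrix to a block only makes the sums smaller, which is harmless by
  \<open>sdd_cone_iff_subweights\<close>.
\<close>
lemma block_diag_in_sdd_cone_iff: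
  assumes d: "2 \<le> d" "2 \<le> e" and A: "A \<in> sym_mats d" and B: "B \<in> sym_mats e"
  shows "block_diag A B \<in> sdd_cone (d + e) \<longleftrightarrow> A \<in> sdd_cone d \<and> B \<in> sdd_cone e"
proof -
  note cA = sym_mats_carrier[OF A] and cB = sym_mats_carrier[OF B]
  let ?D = "block_diag A B"
  have D: "?D $$ (i, j) = (if i < d then if j < d then A $$ (i, j) else 0
      else if j < d then 0 else B $$ (i - d, j - d))" if "i < d + e" "j < d + e" for i j
    using that cA cB by (auto simp: block_diag_def)
  have low: "{..<d + e} - {i} = ({..<d} - {i}) \<union> {d..<d + e}" if "i < d" for i using that by auto
  have high: "{..<d + e} - {d + i} = {..<d} \<union> (\<lambda>j. d + j) ` ({..<e} - {i})" for i
  proof -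
    have shift: "{..<d + e} = {..<d} \<union> (\<lambda>j. d + j) ` {..<e}"
      using image_add_atLeastLessThan[of d 0 e] ivl_disj_un_two(3)[of 0 d "d + e"]
      by (simp add: lessThan_atLeast0 add.commute[of e d])
    show ?thesis unfolding shift by auto
  qed
  have sum_low: "(\<Sum>j\<in>{..<d + e} - {i}. W i j) = (\<Sum>j\<in>{..<d} - {i}. W i j) + (\<Sum>j\<in>{d..<d + e}. W i j)"
    if "i < d" for i and W :: "nat \<Rightarrow> nat \<Rightarrow> real"
    unfolding low[OF that] by (rule sum.union_disjoint) auto
  have sum_high: "(\<Sum>j\<in>{..<d + e} - {d + i}. W (d + i) j) =
      (\<Sum>j<d. W (d + i) j) + (\<Sum>j\<in>{..<e} - {i}. W (d + i) (d + j))"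
    for i and W :: "nat \<Rightarrow> nat \<Rightarrow> real"
    unfolding high by (subst sum.union_disjoint) (auto simp: sum.reindex)
  show ?thesis
  proof
    assume "?D \<in> sdd_cone (d + e)"
    then obtain W where W: "dominating_weights (d + e) ?D W"
      and diag: "\<And>i. i < d + e \<Longrightarrow> (\<Sum>j\<in>{..<d + e} - {i}. W i j) \<le> ?D $$ (i, i)"
      using d by (subst (asm) sdd_cone_iff_subweights) auto
    have pos: "0 \<le> W i j" if "i < d + e" "j < d + e" "i \<noteq> j" for i j
      using W that by (auto simp: dominating_weights_def)
    have entry: "(?D $$ (i, j))\<^sup>2 \<le> W i j * W j i" if "i < d + e" "j < d + e" "i \<noteq> j" for i j
      using W that by (auto simp: dominating_weights_def)
    have "dominating_weights d A W"
      unfolding dominating_weights_def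
    proof (intro allI impI)
      fix i j assume "i < d" "j < d" "i \<noteq> j"
      then show "0 \<le> W i j \<and> (A $$ (i, j))\<^sup>2 \<le> W i j * W j i"
        using pos[of i j] entry[of i j] D[of i j] by simp
    qed
    moreover have "(\<Sum>j\<in>{..<d} - {i}. W i j) \<le> A $$ (i, i)" if "i < d" for i
    proof -
      have "0 \<le> (\<Sum>j\<in>{d..<d + e}. W i j)" using that by (intro sum_nonneg pos) auto
      then show ?thesis using diag[of i] sum_low[OF that, of W] D[of i i] that by simp
    qed
    ultimately have "A \<in> sdd_cone d"
      using A d by (subst sdd_cone_iff_subweights) auto
    have "dominating_weights e B (\<lambda>i j. W (d + i) (d + j))"
      unfolding dominating_weights_def
    proof (intro allI impI)
      fix i j assume "i < e" "j < e" "i \<noteq> j"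
      then show "0 \<le> W (d + i) (d + j) \<and> (B $$ (i, j))\<^sup>2 \<le> W (d + i) (d + j) * W (d + j) (d + i)"
        using pos[of "d + i" "d + j"] entry[of "d + i" "d + j"] D[of "d + i" "d + j"] by simp
    qed
    moreover have "(\<Sum>j\<in>{..<e} - {i}. W (d + i) (d + j)) \<le> B $$ (i, i)" if "i < e" for i
    proof -
      have "0 \<le> (\<Sum>j<d. W (d + i) j)" using that by (intro sum_nonneg pos) auto
      then show ?thesis using diag[of "d + i"] sum_high[of W i] D[of "d + i" "d + i"] that by simp
    qed
    ultimately have "B \<in> sdd_cone e"
      using B d by (subst sdd_cone_iff_subweights) auto
    with \<open>A \<in> sdd_cone d\<close> show "A \<in> sdd_cone d \<and> B \<in> sdd_cone e" ..
  next
    assume "A \<in> sdd_cone d \<and> B \<in> sdd_cone e"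
    then obtain V W where V: "dominating_weights d A V"
        "\<And>i. i < d \<Longrightarrow> (\<Sum>j\<in>{..<d} - {i}. V i j) = A $$ (i, i)"
      and W: "dominating_weights e B W"
        "\<And>i. i < e \<Longrightarrow> (\<Sum>j\<in>{..<e} - {i}. W i j) = B $$ (i, i)"
      unfolding sdd_cone_iff_weights by blast
    define U where "U i j = (if i < d then if j < d then V i j else 0
      else if j < d then 0 else W (i - d) (j - d))" for i j
    have "dominating_weights (d + e) ?D U"
      unfolding dominating_weights_def
    proof (intro allI impI)
      fix i j assume ij: "i < d + e" "j < d + e" "i \<noteq> j"
      then show "0 \<le> U i j \<and> (?D $$ (i, j))\<^sup>2 \<le> U i j * U j i"
        using V(1) W(1) by (auto simp: D U_def dominating_weights_def)
    qed
    moreover have "(\<Sum>j\<in>{..<d + e} - {i}. U i j) = ?D $$ (i, i)" if "i < d + e" for i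
    proof (cases "i < d")
      case True
      then show ?thesis using that V(2)[OF True] sum_low[OF True, of U] D[of i i] by (simp add: U_def)
    next
      case False
      then obtain k where "i = d + k" using le_Suc_ex not_less by blast
      then show ?thesis using that W(2)[of k] sum_high[of U k] D[of i i] by (simp add: U_def)
    qed
    ultimately show "?D \<in> sdd_cone (d + e)"
      using block_diag_in_sym_mats[OF A B] unfolding sdd_cone_iff_weights by blast
  qed
qed

lemma sdd_representable_Int:
  assumes "sdd_representable n F" "sdd_representable n G"
  shows "sdd_representable n (F \<inter> G)"
proof -
  obtain d S e T where d: "2 \<le> d" "2 \<le> e" and S: "affine_sym_map n d S" and T: "affine_sym_map n e T"
    and F: "F = {x \<in> carrier_vec n. S x \<in> sdd_cone d}" and G: "G = {x \<in> carrier_vec n. T x \<in> sdd_cone e}"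
    using assms unfolding sdd_representable_def by blast
  have sym: "S x \<in> sym_mats d" "T x \<in> sym_mats e" if "x \<in> carrier_vec n" for x
    using S T that by (auto simp: affine_sym_map_def)
  have "affine_functional n (\<lambda>x. block_diag (S x) (T x) $$ (i, j))" if "i < d + e" "j < d + e" for i j
  proof -
    have "block_diag (S x) (T x) $$ (i, j) = (if i < d then if j < d then S x $$ (i, j) else 0
      else if j < d then 0 else T x $$ (i - d, j - d))" if "x \<in> carrier_vec n" for x
      using \<open>i < d + e\<close> \<open>j < d + e\<close> sym[OF that, THEN sym_mats_carrier] by (auto simp: block_diag_def)
    moreover have "affine_functional n (\<lambda>x. if i < d then if j < d then S x $$ (i, j) else 0
      else if j < d then 0 else T x $$ (i - d, j - d))"
      using S T that
      by (cases "i < d"; cases "j < d") (simp_all add: affine_sym_map_def affine_functional_const)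
    ultimately show ?thesis by (simp cong: affine_functional_cong)
  qed
  then have "affine_sym_map n (d + e) (\<lambda>x. block_diag (S x) (T x))"
    using sym by (auto simp: affine_sym_map_def intro: block_diag_in_sym_mats)
  moreover have "F \<inter> G = {x \<in> carrier_vec n. block_diag (S x) (T x) \<in> sdd_cone (d + e)}"
    using block_diag_in_sdd_cone_iff[OF d] sym by (auto simp: F G)
  ultimately show ?thesis using d unfolding sdd_representable_def by (meson trans_le_add1)
qed

text \<open>
  The last row and column are \<open>0\<close>. This padding keeps the dimension at least \<open>2\<close> also for the empty
  list, where the constraint is \<open>0 \<le> t\<close>.
\<close>
definition arrow_mat :: "real list \<Rightarrow> real \<Rightarrow> real mat" where
  "arrow_mat u t = mat (length u + 2) (length u + 2) (\<lambda>(i, j).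
    if i = j then if i \<le> length u then t else 0
    else if i = 0 \<and> j \<le> length u then u ! (j - 1)
    else if j = 0 \<and> i \<le> length u then u ! (i - 1) else 0)"

lemma arrow_mat_in_sym_mats: "arrow_mat u t \<in> sym_mats (length u + 2)"
  by (rule sym_matsI) (auto simp: arrow_mat_def)

text \<open>
  If the matrix is in the cone, the diagonal entries in the rows of \<open>u\<close> bound the weights in the first
  column by \<open>t\<close>, so that \<open>u\<^sub>k\<^sup>2 \<le> w\<^sub>k * t\<close> for the weights \<open>w\<^sub>k\<close> of the first row. These sum to at most
  \<open>t\<close>, and therefore \<open>\<Sum> u\<^sub>k\<^sup>2 \<le> t\<^sup>2\<close>. Conversely \<open>w\<^sub>k = u\<^sub>k\<^sup>2 / t\<close> is the least weight that goes with
  \<open>t\<close> in the first column. For \<open>t = 0\<close> all \<open>u\<^sub>k\<close> vanish, and the value \<open>0\<close> of the quotient is the right weight.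
\<close>
lemma arrow_mat_in_sdd_cone_iff:
  "arrow_mat u t \<in> sdd_cone (length u + 2) \<longleftrightarrow> sqrt (\<Sum>a\<leftarrow>u. a\<^sup>2) \<le> t"
proof -
  define m where "m = length u"
  have norm: "(\<Sum>a\<leftarrow>u. a\<^sup>2) = (\<Sum>k<m. (u ! k)\<^sup>2)"
    by (simp add: sum_list_sum_nth lessThan_atLeast0 m_def)
  have rows: "{..<m + 2} - {0} = Suc ` {..<m} \<union> {m + 1}"
    by (auto simp: image_Suc_lessThan)
  have sum0: "(\<Sum>j\<in>{..<m + 2} - {0}. W j) = (\<Sum>k<m. W (Suc k)) + W (m + 1)" for W :: "nat \<Rightarrow> real"
    unfolding rows by (subst sum.union_disjoint) (auto simp: sum.reindex)
  have arrow: "arrow_mat u t $$ (i, j) = (if i = j then if i \<le> m then t else 0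
    else if i = 0 \<and> j \<le> m then u ! (j - 1)
    else if j = 0 \<and> i \<le> m then u ! (i - 1) else 0)" if "i < m + 2" "j < m + 2" for i j
    using that by (simp add: arrow_mat_def m_def)
  show ?thesis
  proof
    assume "arrow_mat u t \<in> sdd_cone (length u + 2)"
    then obtain W where W: "dominating_weights (m + 2) (arrow_mat u t) W"
      and diag: "\<And>i. i < m + 2 \<Longrightarrow> (\<Sum>j\<in>{..<m + 2} - {i}. W i j) = arrow_mat u t $$ (i, i)"
      unfolding sdd_cone_iff_weights m_def by blast
    have pos: "0 \<le> W i j" if "i < m + 2" "j < m + 2" "i \<noteq> j" for i j
      using W that by (auto simp: dominating_weights_def)
    have entry: "(arrow_mat u t $$ (i, j))\<^sup>2 \<le> W i j * W j i" if "i < m + 2" "j < m + 2" "i \<noteq> j" for i j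
      using W that by (auto simp: dominating_weights_def)
    have tip: "(\<Sum>k<m. W 0 (Suc k)) \<le> t"
      using diag[of 0] sum0[of "W 0"] pos[of 0 "m + 1"] arrow[of 0 0] by simp
    moreover have "0 \<le> (\<Sum>k<m. W 0 (Suc k))" by (intro sum_nonneg pos) auto
    ultimately have t: "0 \<le> t" by linarith
    have shaft: "W (Suc k) 0 \<le> t" if "k < m" for k
    proof -
      have "W (Suc k) 0 \<le> (\<Sum>j\<in>{..<m + 2} - {Suc k}. W (Suc k) j)"
        using that by (intro member_le_sum pos) auto
      then show ?thesis using diag[of "Suc k"] arrow[of "Suc k" "Suc k"] that by simp
    qed
    have "(u ! k)\<^sup>2 \<le> W 0 (Suc k) * t" if "k < m" for k
    proof -
      have "(u ! k)\<^sup>2 \<le> W 0 (Suc k) * W (Suc k) 0"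
        using entry[of 0 "Suc k"] arrow[of 0 "Suc k"] that by simp
      also have "\<dots> \<le> W 0 (Suc k) * t"
        using that by (intro mult_left_mono shaft pos) auto
      finally show ?thesis .
    qed
    then have "(\<Sum>k<m. (u ! k)\<^sup>2) \<le> (\<Sum>k<m. W 0 (Suc k)) * t"
      unfolding sum_distrib_right by (intro sum_mono) auto
    also have "\<dots> \<le> t * t" using tip t by (rule mult_right_mono)
    finally have "(\<Sum>k<m. (u ! k)\<^sup>2) \<le> t\<^sup>2" by (simp add: power2_eq_square)
    then show "sqrt (\<Sum>a\<leftarrow>u. a\<^sup>2) \<le> t"
      unfolding norm using t by (rule real_le_lsqrt[rotated])
  next
    assume "sqrt (\<Sum>a\<leftarrow>u. a\<^sup>2) \<le> t"
    then have u: "sqrt (\<Sum>k<m. (u ! k)\<^sup>2) \<le> t" by (simp add: norm)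
    have "0 \<le> sqrt (\<Sum>k<m. (u ! k)\<^sup>2)" by (simp add: sum_nonneg)
    then have t: "0 \<le> t" using u by linarith
    have sq: "(\<Sum>k<m. (u ! k)\<^sup>2) \<le> t\<^sup>2" using sqrt_le_D[OF u] .
    have zero: "u ! k = 0" if "t = 0" "k < m" for k
    proof -
      have "(\<Sum>k<m. (u ! k)\<^sup>2) = 0" 
        using sq that sum_nonneg[of "{..<m}" "\<lambda>k. (u ! k)\<^sup>2"] by simp
      then show ?thesis using that by (subst (asm) sum_nonneg_eq_0_iff) auto
    qed
    define W where "W i j = (if i = 0 \<and> 0 < j \<and> j \<le> m then (u ! (j - 1))\<^sup>2 / t
      else if j = 0 \<and> 0 < i \<and> i \<le> m then t else 0)" for i j
    have "dominating_weights (m + 2) (arrow_mat u t) W"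
      unfolding dominating_weights_def
    proof (intro allI impI)
      fix i j assume ij: "i < m + 2" "j < m + 2" "i \<noteq> j"
      then show "0 \<le> W i j \<and> (arrow_mat u t $$ (i, j))\<^sup>2 \<le> W i j * W j i"
        using t zero[of "i - 1"] zero[of "j - 1"] by (auto simp: arrow W_def)
    qed
    moreover have "(\<Sum>j\<in>{..<m + 2} - {i}. W i j) \<le> arrow_mat u t $$ (i, i)" if i: "i < m + 2" for i
    proof (cases "i = 0")
      case True
      have "(\<Sum>k<m. (u ! k)\<^sup>2 / t) \<le> t"
        using sq t by (cases "t = 0") (simp_all add: sum_divide_distrib[symmetric] divide_le_eq power2_eq_square)
      then show ?thesis using True sum0[of "W 0"] by (simp add: W_def arrow)
    next
      case False
      have "(\<Sum>j\<in>{..<m + 2} - {i}. W i j) = (\<Sum>j\<in>{0}. W i j)"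
        using False by (intro sum.mono_neutral_right) (auto simp: W_def)
      then show ?thesis using False i t by (simp add: W_def arrow)
    qed
    ultimately show "arrow_mat u t \<in> sdd_cone (length u + 2)"
      using arrow_mat_in_sym_mats[of u t] by (subst sdd_cone_iff_subweights) (auto simp: m_def)
  qed
qed

lemma sdd_representable_norm_cone:
  assumes us: "\<And>u. u \<in> set us \<Longrightarrow> affine_functional n u" and t: "affine_functional n t"
  shows "sdd_representable n {x \<in> carrier_vec n. sqrt (\<Sum>u\<leftarrow>us. (u x)\<^sup>2) \<le> t x}"
proof -
  let ?S = "\<lambda>x. arrow_mat (map (\<lambda>u. u x) us) (t x)" and ?d = "length us + 2"
  have "affine_functional n (\<lambda>x. ?S x $$ (i, j))" if "i < ?d" "j < ?d" for i j
  proof -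
    have "?S x $$ (i, j) = (if i = j then if i \<le> length us then t x else 0
      else if i = 0 \<and> j \<le> length us then (us ! (j - 1)) x
      else if j = 0 \<and> i \<le> length us then (us ! (i - 1)) x else 0)" for x
      using that by (auto simp: arrow_mat_def)
    moreover have "affine_functional n (us ! (k - 1))" if "k \<noteq> 0" "k \<le> length us" for k
      using that by (intro us nth_mem) auto
    ultimately show ?thesis
      using t by (auto intro!: affine_functional_if affine_functional_const)
  qed
  then have "affine_sym_map n ?d ?S"
    using arrow_mat_in_sym_mats[of "map (\<lambda>u. u _) us"] by (simp add: affine_sym_map_def)
  moreover have "?S x \<in> sdd_cone ?d \<longleftrightarrow> sqrt (\<Sum>u\<leftarrow>us. (u x)\<^sup>2) \<le> t x" for x
    using arrow_mat_in_sdd_cone_iff[of "map (\<lambda>u. u x) us" "t x"] by (simp add: o_def)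
  ultimately show ?thesis unfolding sdd_representable_def
    by (intro exI[of _ ?d] exI[of _ ?S]) auto
qed

lemma sdd_representable_norm_cone_set:
  assumes "affine_norm_cones n C" shows "sdd_representable n (norm_cone_set n C)"
proof -
  have "finite C" using assms by (simp add: affine_norm_cones_def)
  then show ?thesis using assms
  proof (induction C rule: finite_induct)
    case empty
    then show ?case using sdd_representable_carrier by (simp add: norm_cone_set_def)
  next
    case (insert p C)
    obtain us t where p: "p = (us, t)" by (cases p)
    have "norm_cone_set n (insert p C) =
      {x \<in> carrier_vec n. sqrt (\<Sum>u\<leftarrow>us. (u x)\<^sup>2) \<le> t x} \<inter> norm_cone_set n C"
      by (auto simp: norm_cone_set_def p)
    moreover have "sdd_representable n {x \<in> carrier_vec n. sqrt (\<Sum>u\<leftarrow>us. (u x)\<^sup>2) \<le> t x}"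
      using insert.prems by (intro sdd_representable_norm_cone) (auto simp: affine_norm_cones_def p)
    moreover have "sdd_representable n (norm_cone_set n C)"
      using insert by (auto simp: affine_norm_cones_def)
    ultimately show ?case by (simp add: sdd_representable_Int)
  qed
qed

section \<open>Casting second-order cone programs into SDD programs\<close>

text \<open>
  Differences of values of \<open>S\<close> serve as coefficient matrices because they inherit symmetry from \<open>S\<close>.
\<close>
lemma affine_sym_map_expand:
  assumes S: "affine_sym_map n d S" and x: "x \<in> carrier_vec n"
  shows "S x = finsum (sym_space d) (\<lambda>i. x $ (i - 1) \<cdot>\<^sub>m (S (unit_vec n (i - 1)) - S (0\<^sub>v n))) {1..n} + S (0\<^sub>v n)"
proof -
  have sym: "S y \<in> sym_mats d" if "y \<in> carrier_vec n" for y
    using S that by (simp add: affine_sym_map_def)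
  note dims = sym[THEN sym_mats_carrier]
  have diff: "S (unit_vec n (i - 1)) - S (0\<^sub>v n) \<in> sym_mats d" for i
    by (intro diff_in_sym_mats sym) auto
  have "finsum (sym_space d) (\<lambda>i. x $ (i - 1) \<cdot>\<^sub>m (S (unit_vec n (i - 1)) - S (0\<^sub>v n))) {1..n} =
    mat d d (\<lambda>kl. \<Sum>i\<in>{1..n}. (x $ (i - 1) \<cdot>\<^sub>m (S (unit_vec n (i - 1)) - S (0\<^sub>v n))) $$ kl)" (is "_ = ?Z")
    using smult_in_sym_mats[OF diff] by (intro finsum_sym_space) auto
  moreover have "S x = ?Z + S (0\<^sub>v n)"
  proof (rule eq_matI)
    fix k l assume "k < dim_row (?Z + S (0\<^sub>v n))" "l < dim_col (?Z + S (0\<^sub>v n))"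
    then have kl: "k < d" "l < d" using dims[of "0\<^sub>v n"] by auto
    have "?Z $$ (k, l) = (\<Sum>i\<in>{1..n}. x $ (i - 1) * (S (unit_vec n (i - 1)) $$ (k, l) - S (0\<^sub>v n) $$ (k, l)))"
      using kl dims[of "unit_vec n _"] dims[of "0\<^sub>v n"] by (auto intro!: sum.cong)
    also have "\<dots> = (\<Sum>i<n. gradient n (\<lambda>x. S x $$ (k, l)) $ i * x $ i)"
      by (rule sum.reindex_bij_witness[of _ Suc "\<lambda>i. i - 1"]) (auto simp: gradient_def)
    finally show "S x $$ (k, l) = (?Z + S (0\<^sub>v n)) $$ (k, l)"
      using affine_functional_expand[of n "\<lambda>x. S x $$ (k, l)" x] S x kl dims[of "0\<^sub>v n"]
      by (simp add: affine_sym_map_def)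
  qed (use dims[OF x] dims[of "0\<^sub>v n"] in auto)
  ultimately show ?thesis by simp
qed

lemma sdd_inequality_of_representable:
  assumes F: "sdd_representable n F" and a: "a \<in> carrier_vec n"
  shows "is_sdd_inequality
    \<lparr>var_space = module_vec TYPE(real) n, feasible = F, objective = (\<lambda>x. a \<bullet> x)\<rparr>"
proof -
  obtain d S where d: "2 \<le> d" and S: "affine_sym_map n d S"
    and F: "F = {x \<in> carrier_vec n. S x \<in> sdd_cone d}"
    using F unfolding sdd_representable_def by blast
  have sym: "S y \<in> sym_mats d" if "y \<in> carrier_vec n" for y
    using S that by (simp add: affine_sym_map_def)
  define P where "P i = (if i = 0 then S (0\<^sub>v n) else S (unit_vec n (i - 1)) - S (0\<^sub>v n))" for i
  have "P i \<in> sym_mats d" for i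
    using sym diff_in_sym_mats by (simp add: P_def)
  moreover have "finsum (sym_space d) (\<lambda>i. x $ (i - 1) \<cdot>\<^sub>m P i) {1..n} + P 0 = S x"
    if "x \<in> carrier_vec n" for x
  proof -
    interpret abelian_monoid "sym_space d" by (rule abelian_monoid_sym_space)
    have "finsum (sym_space d) (\<lambda>i. x $ (i - 1) \<cdot>\<^sub>m P i) {1..n} =
      finsum (sym_space d) (\<lambda>i. x $ (i - 1) \<cdot>\<^sub>m (S (unit_vec n (i - 1)) - S (0\<^sub>v n))) {1..n}"
      using sym by (intro finsum_cong') (auto simp: P_def sym_space_def intro!: smult_in_sym_mats diff_in_sym_mats)
    then show ?thesis using affine_sym_map_expand[OF S that] by (simp add: P_def)
  qed
  ultimately show ?thesis
    unfolding is_sdd_inequality_def using d a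
    by (intro exI[of _ d] exI[of _ n] exI[of _ a] exI[of _ P])
      (auto simp: sdd_inequality_def F)
qed

lemma can_be_cast_into_refl: "can_be_cast_into P P"
  unfolding can_be_cast_into_def affine_map_def by (intro exI[of _ id]) auto

lemma socp_can_be_cast_into_sdd_inequality:
  assumes "is_socp P"
  shows "\<exists>Q. is_sdd_inequality Q \<and> can_be_cast_into P Q"
  using assms
proof (rule norm_cones_of_socp)
  fix n a C assume "a \<in> carrier_vec n" "affine_norm_cones n C"
    and P: "P = \<lparr>var_space = module_vec TYPE(real) n, feasible = norm_cone_set n C, objective = (\<lambda>x. a \<bullet> x)\<rparr>"
  then have "is_sdd_inequality P"
    by (simp add: sdd_inequality_of_representable sdd_representable_norm_cone_set)
  then show ?thesis using can_be_cast_into_refl by blast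
qed

section \<open>Casting SDD programs into second-order cone programs\<close>

text \<open>
  Both sides are compared through \<open>(w + w')\<^sup>2 - (w - w')\<^sup>2 = 4 * w * w'\<close>.
\<close>
lemma rotated_cone_iff_norm:
  fixes s w w' :: real
  shows "sqrt ((2 * s)\<^sup>2 + (w - w')\<^sup>2) \<le> w + w' \<longleftrightarrow> 0 \<le> w \<and> 0 \<le> w' \<and> s\<^sup>2 \<le> w * w'"
proof -
  have sq: "(w + w')\<^sup>2 - ((2 * s)\<^sup>2 + (w - w')\<^sup>2) = 4 * (w * w' - s\<^sup>2)"
    by (simp add: power2_eq_square algebra_simps)
  show ?thesis
  proof
    assume *: "sqrt ((2 * s)\<^sup>2 + (w - w')\<^sup>2) \<le> w + w'"
    moreover have "0 \<le> sqrt ((2 * s)\<^sup>2 + (w - w')\<^sup>2)" by simp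
    ultimately have nonneg: "0 \<le> w + w'" by linarith
    have "0 \<le> 4 * (w * w' - s\<^sup>2)"
      unfolding sq[symmetric] diff_ge_0_iff_ge using * by (rule sqrt_le_D)
    then have s: "s\<^sup>2 \<le> w * w'" by simp
    then have "0 \<le> w * w'" by (meson order_trans zero_le_power2)
    then show "0 \<le> w \<and> 0 \<le> w' \<and> s\<^sup>2 \<le> w * w'"
      using nonneg s by (auto simp: zero_le_mult_iff)
  next
    assume *: "0 \<le> w \<and> 0 \<le> w' \<and> s\<^sup>2 \<le> w * w'"
    then have "0 \<le> (w + w')\<^sup>2 - ((2 * s)\<^sup>2 + (w - w')\<^sup>2)" unfolding sq by simp
    then have "(2 * s)\<^sup>2 + (w - w')\<^sup>2 \<le> (w + w')\<^sup>2" by (simp only: diff_ge_0_iff_ge)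
    then show "sqrt ((2 * s)\<^sup>2 + (w - w')\<^sup>2) \<le> w + w'"
      using * by (intro real_le_lsqrt) auto
  qed
qed

lemma affine_map_vec_first:
  "affine_map (module_vec TYPE(real) (m + k)) (module_vec TYPE(real) m) (\<lambda>v. vec_first v m)"
  unfolding affine_map_def module_vec_simps by (auto simp: vec_first_def)

lemma affine_map_comp:
  assumes "affine_map U V f" "affine_map V W g"
  shows "affine_map U W (\<lambda>x. g (f x))"
  using assms unfolding affine_map_def by (auto simp: Pi_iff)

text \<open>
  The SOCP has variables \<open>(x, W)\<close>: after the \<open>m\<close> coordinates of \<open>x\<close> come the \<open>d * d\<close> weights, row by row.
  The diagonal ones are unconstrained; with them a weight has the plain index \<open>i * d + j\<close>.
\<close>
definition weight_coord :: "nat \<Rightarrow> nat \<Rightarrow> real vec \<Rightarrow> nat \<Rightarrow> nat \<Rightarrow> real" where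
  "weight_coord m d v i j = v $ (m + (i * d + j))"

lemma pair_index_less:
  assumes "i < d" "j < d" shows "i * d + j < d * (d :: nat)"
proof -
  have "i * d + j < Suc i * d" using assms(2) by simp
  also have "\<dots> \<le> d * d" using assms(1) by (intro mult_right_mono) auto
  finally show ?thesis .
qed

lemma affine_functional_weight_coord:
  "i < d \<Longrightarrow> j < d \<Longrightarrow> affine_functional (m + d * d) (\<lambda>v. weight_coord m d v i j)"
  unfolding weight_coord_def by (intro affine_functional_coord add_strict_left_mono pair_index_less)

lemma obtain_weight_coord:
  assumes "x \<in> carrier_vec m"
  obtains v where "v \<in> carrier_vec (m + d * d)" "vec_first v m = x"
    "\<And>i j. i < d \<Longrightarrow> j < d \<Longrightarrow> weight_coord m d v i j = W i j"
proof
  let ?v = "x @\<^sub>v vec (d * d) (\<lambda>k. W (k div d) (k mod d))"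
  show "?v \<in> carrier_vec (m + d * d)" using assms by auto
  show "vec_first ?v m = x" using assms by (auto simp: vec_first_def intro!: eq_vecI)
  show "weight_coord m d ?v i j = W i j" if "i < d" "j < d" for i j
    using assms that pair_index_less[OF that] by (auto simp: weight_coord_def)
qed

text \<open>
  This treats both forms of SDD programs at once. The map \<open>\<phi>\<close> leads from the parameters \<open>x\<close> to the
  variable of the program; it is the identity for the inequality form and the parametrisation of
  symmetric matrices for the standard form, where \<open>G\<close> contains the trace equations. The cast first
  forgets the weights and then applies \<open>\<phi>\<close>.
\<close>
lemma sdd_system_can_be_cast_into_socp:
  fixes P :: "'p program"
  assumes S: "affine_sym_map m d S"
    and G: "finite G" "\<And>g. g \<in> G \<Longrightarrow> affine_functional m g"
    and f: "affine_functional m f" "f (0\<^sub>v m) = 0"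
    and \<phi>: "affine_map (module_vec TYPE(real) m) (var_space P) \<phi>"
    and feas: "feasible P = \<phi> ` {x \<in> carrier_vec m. (\<forall>g\<in>G. g x = 0) \<and> S x \<in> sdd_cone d}"
    and obj: "\<And>x. x \<in> carrier_vec m \<Longrightarrow> objective P (\<phi> x) = f x"
  shows "\<exists>Q. is_socp Q \<and> can_be_cast_into P Q"
proof -
  define N where "N = m + d * d"
  let ?x = "\<lambda>v. vec_first v m" and ?W = "weight_coord m d"
  define C\<^sub>1 :: "norm_cone set" where "C\<^sub>1 = (\<lambda>(i, j).
    ([\<lambda>v. 2 * S (?x v) $$ (i, j), \<lambda>v. ?W v i j - ?W v j i], \<lambda>v. ?W v i j + ?W v j i)) `
    {(i, j). i < d \<and> j < d \<and> i \<noteq> j}"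
  define C\<^sub>2 :: "norm_cone set" where "C\<^sub>2 = (\<lambda>i.
    ([\<lambda>v. (\<Sum>j\<in>{..<d} - {i}. ?W v i j) - S (?x v) $$ (i, i)], \<lambda>v. 0)) ` {..<d}"
  define C\<^sub>3 :: "norm_cone set" where "C\<^sub>3 = (\<lambda>g. ([\<lambda>v. g (?x v)], \<lambda>v. 0)) ` G"
  have S_aff: "affine_functional N (\<lambda>v. S (?x v) $$ (i, j))" if "i < d" "j < d" for i j
    using affine_functional_vec_first[of m "\<lambda>x. S x $$ (i, j)"] S that
    by (simp add: affine_sym_map_def N_def)
  have W_aff: "affine_functional N (\<lambda>v. ?W v i j)" if "i < d" "j < d" for i j
    using affine_functional_weight_coord that by (simp add: N_def)
  have g_aff: "affine_functional N (\<lambda>v. g (?x v))" if "g \<in> G" for g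
    using affine_functional_vec_first G(2)[OF that] by (simp add: N_def)
  have "finite {(i, j). i < d \<and> j < d \<and> i \<noteq> j}"
    by (rule finite_subset[of _ "{..<d} \<times> {..<d}"]) auto
  then have "finite (C\<^sub>1 \<union> C\<^sub>2 \<union> C\<^sub>3)" using G(1) by (simp add: C\<^sub>1_def C\<^sub>2_def C\<^sub>3_def)
  moreover have "(\<forall>u\<in>set us. affine_functional N u) \<and> affine_functional N t"
    if "(us, t) \<in> C\<^sub>1 \<union> C\<^sub>2 \<union> C\<^sub>3" for us t
    using that
  proof (elim UnE)
    assume "(us, t) \<in> C\<^sub>1"
    then show ?thesis
      by (auto simp: C\<^sub>1_def intro!: affine_functional_add affine_functional_diff
          affine_functional_cmult S_aff W_aff)
  next
    assume "(us, t) \<in> C\<^sub>2"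
    then show ?thesis
      by (auto simp: C\<^sub>2_def intro!: affine_functional_diff affine_functional_sum
          affine_functional_const S_aff W_aff)
  next
    assume "(us, t) \<in> C\<^sub>3"
    then show ?thesis by (auto simp: C\<^sub>3_def intro!: affine_functional_const g_aff)
  qed
  ultimately have C: "affine_norm_cones N (C\<^sub>1 \<union> C\<^sub>2 \<union> C\<^sub>3)"
    unfolding affine_norm_cones_def by blast
  have "vec_first (0\<^sub>v N) m = (0\<^sub>v m :: real vec)" by (auto simp: vec_first_def N_def)
  then obtain Q where Q: "is_socp Q" "var_space Q = module_vec TYPE(real) N"
    "feasible Q = norm_cone_set N (C\<^sub>1 \<union> C\<^sub>2 \<union> C\<^sub>3)"
    "\<And>v. v \<in> carrier_vec N \<Longrightarrow> objective Q v = f (?x v)"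
    using socp_of_norm_cones[OF C, of "\<lambda>v. f (?x v)"] affine_functional_vec_first[OF f(1), of "d * d"] f(2)
    unfolding N_def by metis
  have feasQ: "v \<in> feasible Q \<longleftrightarrow> v \<in> carrier_vec N \<and> dominating_weights d (S (?x v)) (?W v) \<and>
    (\<forall>i<d. (\<Sum>j\<in>{..<d} - {i}. ?W v i j) = S (?x v) $$ (i, i)) \<and> (\<forall>g\<in>G. g (?x v) = 0)" for v
  proof -
    have "(\<forall>(us, t)\<in>C\<^sub>1. sqrt (\<Sum>u\<leftarrow>us. (u v)\<^sup>2) \<le> t v) \<longleftrightarrow>
        (\<forall>i<d. \<forall>j<d. i \<noteq> j \<longrightarrow> 0 \<le> ?W v i j \<and> 0 \<le> ?W v j i \<and> (S (?x v) $$ (i, j))\<^sup>2 \<le> ?W v i j * ?W v j i)"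
      unfolding rotated_cone_iff_norm[symmetric] by (auto simp: C\<^sub>1_def)
    also have "\<dots> \<longleftrightarrow> dominating_weights d (S (?x v)) (?W v)"
      unfolding dominating_weights_def by blast
    finally have 1: "(\<forall>(us, t)\<in>C\<^sub>1. sqrt (\<Sum>u\<leftarrow>us. (u v)\<^sup>2) \<le> t v) \<longleftrightarrow>
      dominating_weights d (S (?x v)) (?W v)" .
    have 2: "(\<forall>(us, t)\<in>C\<^sub>2. sqrt (\<Sum>u\<leftarrow>us. (u v)\<^sup>2) \<le> t v) \<longleftrightarrow>
      (\<forall>i<d. (\<Sum>j\<in>{..<d} - {i}. ?W v i j) = S (?x v) $$ (i, i))"
      by (auto simp: C\<^sub>2_def)
    have 3: "(\<forall>(us, t)\<in>C\<^sub>3. sqrt (\<Sum>u\<leftarrow>us. (u v)\<^sup>2) \<le> t v) \<longleftrightarrow> (\<forall>g\<in>G. g (?x v) = 0)"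
      by (auto simp: C\<^sub>3_def)
    show ?thesis
      unfolding Q(3) norm_cone_set_def mem_Collect_eq ball_Un 1 2 3 by blast
  qed
  have "?x ` feasible Q = {x \<in> carrier_vec m. (\<forall>g\<in>G. g x = 0) \<and> S x \<in> sdd_cone d}"
  proof (intro subset_antisym subsetI)
    fix x assume "x \<in> ?x ` feasible Q"
    then obtain v where v: "v \<in> feasible Q" "x = ?x v" by blast
    then have "S x \<in> sym_mats d" using S by (simp add: affine_sym_map_def)
    then have "S x \<in> sdd_cone d"
      using v feasQ[of v] unfolding sdd_cone_iff_weights by blast
    then show "x \<in> {x \<in> carrier_vec m. (\<forall>g\<in>G. g x = 0) \<and> S x \<in> sdd_cone d}"
      using v feasQ[of v] by simp
  next
    fix x assume x: "x \<in> {x \<in> carrier_vec m. (\<forall>g\<in>G. g x = 0) \<and> S x \<in> sdd_cone d}"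
    then obtain W where W: "dominating_weights d (S x) W"
      "\<And>i. i < d \<Longrightarrow> (\<Sum>j\<in>{..<d} - {i}. W i j) = S x $$ (i, i)"
      unfolding sdd_cone_iff_weights by blast
    obtain v where v: "v \<in> carrier_vec N" "?x v = x" "\<And>i j. i < d \<Longrightarrow> j < d \<Longrightarrow> ?W v i j = W i j"
      using x obtain_weight_coord[of x m d W] unfolding N_def by blast
    have "(\<Sum>j\<in>{..<d} - {i}. ?W v i j) = (\<Sum>j\<in>{..<d} - {i}. W i j)" if "i < d" for i
      using v(3) that by (intro sum.cong) auto
    then have "v \<in> feasible Q"
      using v x W by (simp add: feasQ dominating_weights_def)
    then show "x \<in> ?x ` feasible Q" using v(2) by blast
  qed
  then have "(\<lambda>v. \<phi> (?x v)) ` feasible Q = feasible P"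
    unfolding feas image_image[of \<phi> ?x, symmetric] by simp
  moreover have "affine_map (var_space Q) (var_space P) (\<lambda>v. \<phi> (?x v))"
    unfolding Q(2) N_def using affine_map_vec_first \<phi> by (rule affine_map_comp)
  moreover have "objective P (\<phi> (?x v)) = objective Q v" if "v \<in> feasible Q" for v
    using that feasQ[of v] by (simp add: obj Q(4))
  ultimately show ?thesis
    using Q(1) unfolding can_be_cast_into_def by blast
qed

lemma sdd_inequality_can_be_cast_into_socp:
  assumes "is_sdd_inequality R"
  shows "\<exists>Q. is_socp Q \<and> can_be_cast_into R Q"
proof -
  obtain d n q P where q: "q \<in> carrier_vec n" and P: "\<And>i. i \<in> {0..n} \<Longrightarrow> P i \<in> sym_mats d"
    and R: "R = sdd_inequality d n q P"
    using assms unfolding is_sdd_inequality_def by blast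
  let ?S = "\<lambda>x :: real vec. finsum (sym_space d) (\<lambda>i. x $ (i - 1) \<cdot>\<^sub>m P i) {1..n} + P 0"
  have sum: "finsum (sym_space d) (\<lambda>i. x $ (i - 1) \<cdot>\<^sub>m P i) {1..n} =
    mat d d (\<lambda>kl. \<Sum>i\<in>{1..n}. (x $ (i - 1) \<cdot>\<^sub>m P i) $$ kl)" for x :: "real vec"
    using P by (intro finsum_sym_space smult_in_sym_mats) auto
  have dims: "dim_row (P i) = d" "dim_col (P i) = d" if "i \<le> n" for i
    using P[of i] that by (auto simp: sym_mats_def)
  have entry: "?S x $$ (k, l) = (\<Sum>i\<in>{1..n}. P i $$ (k, l) * x $ (i - 1)) + P 0 $$ (k, l)"
    if "k < d" "l < d" for x k l
    unfolding sum using that dims by (auto intro!: sum.cong)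
  have "?S x \<in> sym_mats d" for x
  proof (rule sym_matsI)
    show "?S x \<in> carrier_mat d d" using P[THEN sym_mats_carrier, of 0] by (simp add: sum)
    show "?S x $$ (k, l) = ?S x $$ (l, k)" if "k < d" "l < d" for k l
      using entry that sym_mats_index[OF P that] by simp
  qed
  moreover have "affine_functional n (\<lambda>x. ?S x $$ (k, l))" if "k < d" "l < d" for k l
    unfolding entry[OF that] by (intro affine_functional_intros) auto
  ultimately have S: "affine_sym_map n d ?S" by (simp add: affine_sym_map_def)
  show ?thesis
  proof (rule sdd_system_can_be_cast_into_socp[OF S, of "{}" "\<lambda>x. q \<bullet> x" R id])
    show "affine_map (module_vec TYPE(real) n) (var_space R) id"
      by (simp add: R sdd_inequality_def affine_map_def)
  qed (use q in \<open>auto simp: R sdd_inequality_def affine_functional_scalar_prod\<close>)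
qed

text \<open>
  The vector lists a full \<open>d \<times> d\<close> array of which only the upper triangle is read. The parametrisation
  is thus not injective in general, but a cast only asks for a surjection onto the feasible set.
\<close>
definition sym_mat_of_vec :: "nat \<Rightarrow> real vec \<Rightarrow> real mat" where
  "sym_mat_of_vec d x = mat d d (\<lambda>(i, j). x $ (min i j * d + max i j))"

lemma affine_sym_map_sym_mat_of_vec: "affine_sym_map (d * d) d (sym_mat_of_vec d)"
  unfolding affine_sym_map_def
proof (intro conjI allI impI ballI)
  show "sym_mat_of_vec d x \<in> sym_mats d" for x
    by (rule sym_matsI) (auto simp: sym_mat_of_vec_def min.commute max.commute)
  show "affine_functional (d * d) (\<lambda>x. sym_mat_of_vec d x $$ (i, j))" if "i < d" "j < d" for i j
    using that pair_index_less[of "min i j" d "max i j"]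
    by (simp add: sym_mat_of_vec_def affine_functional_coord)
qed

lemma sym_mat_of_vec_surj: "sym_mat_of_vec d ` carrier_vec (d * d) = sym_mats d"
proof (intro subset_antisym subsetI)
  fix X assume "X \<in> sym_mat_of_vec d ` carrier_vec (d * d)"
  then show "X \<in> sym_mats d" using affine_sym_map_sym_mat_of_vec[of d] by (auto simp: affine_sym_map_def)
next
  fix X assume X: "X \<in> sym_mats d"
  define x where "x = vec (d * d) (\<lambda>k. X $$ (k div d, k mod d))"
  have "X = sym_mat_of_vec d x"
  proof (rule eq_matI)
    fix i j assume "i < dim_row (sym_mat_of_vec d x)" "j < dim_col (sym_mat_of_vec d x)"
    then have ij: "i < d" "j < d" by (auto simp: sym_mat_of_vec_def)
    then have "sym_mat_of_vec d x $$ (i, j) = X $$ (min i j, max i j)"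
      using pair_index_less[of "min i j" d "max i j"] by (simp add: sym_mat_of_vec_def x_def)
    then show "X $$ (i, j) = sym_mat_of_vec d x $$ (i, j)"
      using sym_mats_index[OF X ij] by (simp add: min_def max_def)
  qed (use sym_mats_carrier[OF X] in \<open>auto simp: sym_mat_of_vec_def\<close>)
  then show "X \<in> sym_mat_of_vec d ` carrier_vec (d * d)" by (rule image_eqI) (simp add: x_def)
qed

lemma affine_map_sym_mat_of_vec:
  "affine_map (module_vec TYPE(real) (d * d)) (sym_space d) (sym_mat_of_vec d)"
proof -
  have "sym_mat_of_vec d ((1 - t) \<cdot>\<^sub>v x + t \<cdot>\<^sub>v y) =
      (1 - t) \<cdot>\<^sub>m sym_mat_of_vec d x + t \<cdot>\<^sub>m sym_mat_of_vec d y"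
    if "x \<in> carrier_vec (d * d)" "y \<in> carrier_vec (d * d)" for x y t
    using that pair_index_less[of "min _ _" d "max _ _"]
    by (intro eq_matI) (auto simp: sym_mat_of_vec_def)
  then show ?thesis
    using sym_mat_of_vec_surj[of d]
    by (auto simp: affine_map_def module_vec_simps sym_space_def module_mat_simps module_mat_def)
qed

lemma affine_functional_trace_mat_mult:
  assumes "A \<in> carrier_mat d d"
  shows "affine_functional (d * d) (\<lambda>x. trace_mat (A * sym_mat_of_vec d x))"
proof -
  have "trace_mat (A * sym_mat_of_vec d x) =
      (\<Sum>i<d. \<Sum>k<d. A $$ (i, k) * sym_mat_of_vec d x $$ (k, i))" for x
    using assms by (simp add: trace_mat_def scalar_prod_def lessThan_atLeast0 sym_mat_of_vec_def)
  moreover have "affine_functional (d * d) (\<lambda>x. \<Sum>i<d. \<Sum>k<d. A $$ (i, k) * sym_mat_of_vec d x $$ (k, i))"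
    using affine_sym_map_sym_mat_of_vec[of d]
    by (intro affine_functional_sum affine_functional_cmult) (auto simp: affine_sym_map_def)
  ultimately show ?thesis by simp
qed

lemma sdd_standard_can_be_cast_into_socp:
  assumes "is_sdd_standard P"
  shows "\<exists>Q. is_socp Q \<and> can_be_cast_into P Q"
proof -
  obtain d p A b where A: "\<And>i. i \<in> {0..p} \<Longrightarrow> A i \<in> sym_mats d" and P: "P = sdd_standard d p A b"
    using assms unfolding is_sdd_standard_def by blast
  let ?X = "sym_mat_of_vec d"
  have trace: "affine_functional (d * d) (\<lambda>x. trace_mat (A i * ?X x))" if "i \<in> {0..p}" for i
    using A[OF that] by (intro affine_functional_trace_mat_mult sym_mats_carrier)
  define G where "G = (\<lambda>i x. trace_mat (A i * ?X x) - b i) ` {1..p}"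
  have "?X (0\<^sub>v (d * d)) = 0\<^sub>m d d"
    using pair_index_less[of "min _ _" d "max _ _"] by (intro eq_matI) (auto simp: sym_mat_of_vec_def)
  then have zero: "trace_mat (A 0 * ?X (0\<^sub>v (d * d))) = 0"
    using sym_mats_carrier[OF A[of 0]] by (simp add: trace_mat_def)
  have "feasible P = ?X ` {x \<in> carrier_vec (d * d). (\<forall>g\<in>G. g x = 0) \<and> ?X x \<in> sdd_cone d}"
    unfolding P sdd_standard_def program.select_convs sym_mat_of_vec_surj[symmetric]
    by (auto simp: G_def)
  then show ?thesis
    using affine_map_sym_mat_of_vec[of d] zero trace[of 0]
    by (intro sdd_system_can_be_cast_into_socp[OF affine_sym_map_sym_mat_of_vec,
          of G d "\<lambda>x. trace_mat (A 0 * ?X x)" P ?X])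
      (auto simp: G_def P sdd_standard_def intro!: affine_functional_diff affine_functional_const trace)
qed

theorem theorem3p3:
  shows "(\<forall>P. is_socp P \<longrightarrow>
            (\<exists>Q. is_sdd_standard Q \<and> can_be_cast_into P Q) \<or>
            (\<exists>Q. is_sdd_inequality Q \<and> can_be_cast_into P Q)) \<and>
         (\<forall>P. is_sdd_standard P \<longrightarrow> (\<exists>Q. is_socp Q \<and> can_be_cast_into P Q)) \<and>
         (\<forall>P. is_sdd_inequality P \<longrightarrow> (\<exists>Q. is_socp Q \<and> can_be_cast_into P Q))"
  using socp_can_be_cast_into_sdd_inequality sdd_standard_can_be_cast_into_socp
    sdd_inequality_can_be_cast_into_socp by blast

end
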